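(* Let $X$ be an rr-good (completely regular) space, $V$ a C-embedded subspace of $X$ and $\rho\colon C(X)\to C(V)$ the restriction homomorphism. If $\{f_n\}_{n\in\mathbf{N}}$ is an rr-orthogonal set in $C(V)$ then there is an rr-orthogonal set $\{F_n\}_{n\in\mathbf{N}}$ in $C(X)$ such that for all $n\in\mathbf{N}$, $\rho(F_n)=f_n$.
   Context: $C(X)$ is the ring of continuous real-valued functions on $X$. The reduced ring order (rr-order) on a reduced ring, in particular on $C(X)$, is the partial order $a\le_{\mathrm{rr}} b$ if and only if $ab=a^2$; infima in this order are written $a\wedge_{\mathrm{rr}} b$. A completely regular space $X$ is called rr-good if $C(X)$ is a lower semi-lattice in the rr-order. Elements $r,s$ are rr-orthogonal if $r\wedge_{\mathrm{rr}} s=0$, i.e. $0$ is their only common rr-lower bound; an indexed set is rr-orthogonal if its members with distinct indices are pairwise rr-orthogonal. A subspace $V$ of $X$ is C-embedded if every element of $C(V)$ extends to an element of $C(X)$, i.e. $\rho$ is surjective. Completely regular spaces are taken to be Hausdorff, as in Gillman–Jerison. *)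

theory Defs
  imports "HOL-Algebra.Ring" "HOL-Algebra.Lattice" "HOL-Analysis.Analysis"
begin

text \<open>
  Elements of \<open>C(X)\<close> are extensional, so that equality in the carrier is equality of
  functions on \<open>topspace X\<close>.
\<close>

definition cont_ring :: "'a topology \<Rightarrow> ('a \<Rightarrow> real) ring" where
  "cont_ring X =
    \<lparr> carrier = {f. continuous_map X euclideanreal f} \<inter> extensional (topspace X),
      monoid.mult = (\<lambda>f g. \<lambda>x\<in>topspace X. f x * g x),
      one = (\<lambda>x\<in>topspace X. 1),
      zero = (\<lambda>x\<in>topspace X. 0),
      add = (\<lambda>f g. \<lambda>x\<in>topspace X. f x + g x) \<rparr>"

definition rr_order :: "('a, 'm) ring_scheme \<Rightarrow> 'a gorder" where
  "rr_order R =
    \<lparr> carrier = carrier R,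
      eq = (=),
      le = (\<lambda>a b. a \<otimes>\<^bsub>R\<^esub> b = a [^]\<^bsub>R\<^esub> (2::nat)) \<rparr>"

definition rr_good :: "'a topology \<Rightarrow> bool" where
  "rr_good X \<longleftrightarrow> lower_semilattice (rr_order (cont_ring X))"

text \<open>
  The infimum of two elements need not exist in general, so \<open>r \<and>\<^sub>r\<^sub>r s = 0\<close> means that
  the infimum exists and is zero. Zero is the least element, so this says that it is
  the only common lower bound (see \<open>rr_orthogonal_iff\<close> below).
\<close>

definition rr_orthogonal :: "('a, 'm) ring_scheme \<Rightarrow> 'a \<Rightarrow> 'a \<Rightarrow> bool" where
  "rr_orthogonal R r s \<longleftrightarrow>
     greatest (rr_order R) \<zero>\<^bsub>R\<^esub> (Lower (rr_order R) {r, s})"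

definition rr_orthogonal_family :: "('a, 'm) ring_scheme \<Rightarrow> ('i \<Rightarrow> 'a) \<Rightarrow> bool" where
  "rr_orthogonal_family R f \<longleftrightarrow>
     range f \<subseteq> carrier R \<and> (\<forall>i j. i \<noteq> j \<longrightarrow> rr_orthogonal R (f i) (f j))"

definition restriction :: "'a set \<Rightarrow> ('a \<Rightarrow> real) \<Rightarrow> 'a \<Rightarrow> real" where
  "restriction V f = restrict f V"

definition C_embedded :: "'a topology \<Rightarrow> 'a set \<Rightarrow> bool" where
  "C_embedded X V \<longleftrightarrow>
     V \<subseteq> topspace X \<and>
     restriction V ` carrier (cont_ring X) = carrier (cont_ring (subtopology X V))"

lemma carrier_cont_ring:
  "f \<in> carrier (cont_ring X) \<longleftrightarrow>
     continuous_map X euclideanreal f \<and> f \<in> extensional (topspace X)"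
  by (simp add: cont_ring_def)

lemma restrict_in_cont_ring:
  assumes "continuous_map X euclideanreal f"
  shows "restrict f (topspace X) \<in> carrier (cont_ring X)"
  using assms by (auto simp: carrier_cont_ring intro: continuous_map_eq)

lemma cring_cont_ring: "cring (cont_ring X)"
proof (rule cringI)
  show "abelian_group (cont_ring X)"
  proof (rule abelian_groupI)
    fix f assume f: "f \<in> carrier (cont_ring X)"
    then have "(\<lambda>x\<in>topspace X. - f x) \<in> carrier (cont_ring X)"
      by (auto simp: carrier_cont_ring intro!: restrict_in_cont_ring[unfolded carrier_cont_ring]
          continuous_map_minus)
    then show "\<exists>g\<in>carrier (cont_ring X). g \<oplus>\<^bsub>cont_ring X\<^esub> f = \<zero>\<^bsub>cont_ring X\<^esub>"
      by (rule bexI[rotated]) (auto simp: cont_ring_def)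
  next
    fix f g assume "f \<in> carrier (cont_ring X)" "g \<in> carrier (cont_ring X)"
    then have "continuous_map X euclideanreal (\<lambda>x. f x + g x)"
      by (intro continuous_map_add) (auto simp: carrier_cont_ring)
    from restrict_in_cont_ring[OF this]
    show "f \<oplus>\<^bsub>cont_ring X\<^esub> g \<in> carrier (cont_ring X)"
      by (simp add: cont_ring_def)
  qed (use restrict_in_cont_ring[of X "\<lambda>x. 0"] in
        \<open>auto simp: cont_ring_def restrict_def extensional_def fun_eq_iff\<close>)
next
  have m: "f \<otimes>\<^bsub>cont_ring X\<^esub> g \<in> carrier (cont_ring X)"
    if "f \<in> carrier (cont_ring X)" "g \<in> carrier (cont_ring X)" for f g
  proof -
    from that have "continuous_map X euclideanreal (\<lambda>x. f x * g x)"
      by (intro continuous_map_real_mult) (auto simp: carrier_cont_ring)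
    from restrict_in_cont_ring[OF this] show ?thesis
      by (simp add: cont_ring_def)
  qed
  show "comm_monoid (cont_ring X)"
    by (rule comm_monoidI)
      (use m restrict_in_cont_ring[of X "\<lambda>x. 1"] in
        \<open>auto simp: cont_ring_def restrict_def extensional_def fun_eq_iff\<close>)
qed (auto simp: cont_ring_def restrict_def fun_eq_iff algebra_simps)

lemma rr_le_cont_ring:
  assumes "f \<in> carrier (cont_ring X)"
  shows "f \<sqsubseteq>\<^bsub>rr_order (cont_ring X)\<^esub> g \<longleftrightarrow> (\<forall>x\<in>topspace X. f x = 0 \<or> f x = g x)"
proof -
  interpret cring "cont_ring X" by (rule cring_cont_ring)
  from assms have "f [^]\<^bsub>cont_ring X\<^esub> (2::nat) = f \<otimes>\<^bsub>cont_ring X\<^esub> f"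
    by (simp add: numeral_2_eq_2)
  then show ?thesis
    by (auto simp: rr_order_def cont_ring_def restrict_def fun_eq_iff)
qed

lemma carrier_rr_order [simp]: "carrier (rr_order R) = carrier R"
  by (simp add: rr_order_def)

lemma eq_rr_order [simp]: "(.=\<^bsub>rr_order R\<^esub>) = (=)"
  by (simp add: rr_order_def)

lemma partial_order_rr_order_cont_ring: "partial_order (rr_order (cont_ring X))"
proof
  fix f g
  assume "f \<sqsubseteq>\<^bsub>rr_order (cont_ring X)\<^esub> g" "g \<sqsubseteq>\<^bsub>rr_order (cont_ring X)\<^esub> f"
    "f \<in> carrier (rr_order (cont_ring X))" "g \<in> carrier (rr_order (cont_ring X))"
  then have "\<forall>x\<in>topspace X. f x = g x"
    "f \<in> extensional (topspace X)" "g \<in> extensional (topspace X)"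
    by (auto simp: rr_le_cont_ring carrier_cont_ring) (metis)
  then show "f .=\<^bsub>rr_order (cont_ring X)\<^esub> g"
    by (auto intro: extensionalityI)
qed (auto simp: rr_le_cont_ring, metis+)

lemma rr_good_iff:
  "rr_good X \<longleftrightarrow>
     (\<forall>f\<in>carrier (cont_ring X). \<forall>g\<in>carrier (cont_ring X).
        \<exists>h. greatest (rr_order (cont_ring X)) h (Lower (rr_order (cont_ring X)) {f, g}))"
  unfolding rr_good_def lower_semilattice_def lower_semilattice_axioms_def
  using partial_order_rr_order_cont_ring by auto

lemma rr_orthogonal_iff:
  "rr_orthogonal (cont_ring X) r s \<longleftrightarrow>
    Lower (rr_order (cont_ring X)) {r, s} = {\<zero>\<^bsub>cont_ring X\<^esub>}"
proof -
  let ?L = "rr_order (cont_ring X)" and ?z = "\<zero>\<^bsub>cont_ring X\<^esub>"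
  interpret cring "cont_ring X" by (rule cring_cont_ring)
  interpret L: partial_order ?L by (rule partial_order_rr_order_cont_ring)
  have z: "?z \<in> carrier (cont_ring X)" by simp
  have z0: "?z x = 0" if "x \<in> topspace X" for x
    using that by (simp add: cont_ring_def)
  have bot: "?z \<sqsubseteq>\<^bsub>?L\<^esub> f" for f
    by (simp add: rr_le_cont_ring[OF z] z0)
  have "f = ?z" if "f \<sqsubseteq>\<^bsub>?L\<^esub> ?z" "f \<in> carrier (cont_ring X)" for f
    using L.le_antisym[OF that(1) bot] that z by simp
  note below = this
  let ?B = "Lower ?L {r, s}"
  have B: "?B \<subseteq> carrier (cont_ring X)" "?z \<in> ?B"
    using bot z by (auto simp: Lower_def)
  have "(\<forall>f\<in>?B. f \<sqsubseteq>\<^bsub>?L\<^esub> ?z) \<longleftrightarrow> (\<forall>f\<in>?B. f = ?z)"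
  proof (intro ball_cong refl iffI)
    fix f assume "f \<in> ?B" "f \<sqsubseteq>\<^bsub>?L\<^esub> ?z"
    then show "f = ?z" using below[of f] B(1) by blast
  next
    fix f assume "f = ?z"
    then show "f \<sqsubseteq>\<^bsub>?L\<^esub> ?z" using bot[of ?z] by simp
  qed
  moreover have "(\<forall>f\<in>?B. f = ?z) \<longleftrightarrow> ?B = {?z}"
    using B(2) by blast
  moreover have "rr_orthogonal (cont_ring X) r s \<longleftrightarrow> (\<forall>f\<in>?B. f \<sqsubseteq>\<^bsub>?L\<^esub> ?z)"
    using B by (simp only: rr_orthogonal_def greatest_def carrier_rr_order simp_thms)
  ultimately show ?thesis by (simp only:)
qed

end

theory Submission
  imports Defs
begin

text \<open>
  Extend each \<open>f n\<close> arbitrarily and correct the extensions one after another. If \<open>g\<close> extends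
  \<open>f n\<close> and \<open>k\<close> is an already constructed extension of some \<open>f i\<close> with \<open>i < n\<close>, then the infimum
  \<open>h\<close> of \<open>g\<close> and \<open>k\<close> restricts to a common lower bound of \<open>f n\<close> and \<open>f i\<close>, hence to zero. So
  \<open>g - h\<close> still extends \<open>f n\<close>. It lies below \<open>g\<close>, which preserves all orthogonality relations
  achieved before, and vanishes wherever \<open>h\<close> does not, which makes it orthogonal to \<open>k\<close>.
\<close>

lemma Lower_rr_cont_ring:
  assumes "r \<in> carrier (cont_ring X)" "s \<in> carrier (cont_ring X)"
  shows "h \<in> Lower (rr_order (cont_ring X)) {r, s} \<longleftrightarrow>
    h \<in> carrier (cont_ring X) \<and> (\<forall>x\<in>topspace X. h x = 0 \<or> h x = r x \<and> h x = s x)"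
proof -
  have "h \<in> Lower (rr_order (cont_ring X)) {r, s} \<longleftrightarrow> h \<in> carrier (cont_ring X) \<and>
      h \<sqsubseteq>\<^bsub>rr_order (cont_ring X)\<^esub> r \<and> h \<sqsubseteq>\<^bsub>rr_order (cont_ring X)\<^esub> s"
    using assms unfolding Lower_def by auto
  then show ?thesis
    using rr_le_cont_ring[of h X] by blast
qed

text \<open>The rr-order is decided point by point, and an extensional function vanishing on the
  space is the zero of the ring. Orthogonality can thus be tested on values alone.\<close>

lemma rr_orthogonal_cont_ring_iff:
  assumes "r \<in> carrier (cont_ring X)" "s \<in> carrier (cont_ring X)"
  shows "rr_orthogonal (cont_ring X) r s \<longleftrightarrow>
    (\<forall>h\<in>carrier (cont_ring X). (\<forall>x\<in>topspace X. h x = 0 \<or> h x = r x \<and> h x = s x) \<longrightarrow>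
      (\<forall>x\<in>topspace X. h x = 0))"
proof -
  interpret cring "cont_ring X" by (rule cring_cont_ring)
  have z0: "\<zero>\<^bsub>cont_ring X\<^esub> x = 0" if "x \<in> topspace X" for x
    using that by (simp add: cont_ring_def)
  have z: "h = \<zero>\<^bsub>cont_ring X\<^esub> \<longleftrightarrow> (\<forall>x\<in>topspace X. h x = 0)" if "h \<in> carrier (cont_ring X)" for h
    using that zero_closed z0 by (auto simp: carrier_cont_ring intro: extensionalityI)
  have "\<zero>\<^bsub>cont_ring X\<^esub> \<in> Lower (rr_order (cont_ring X)) {r, s}"
    using assms z0 by (simp add: Lower_rr_cont_ring)
  then have "rr_orthogonal (cont_ring X) r s \<longleftrightarrow>
      (\<forall>h\<in>Lower (rr_order (cont_ring X)) {r, s}. h = \<zero>\<^bsub>cont_ring X\<^esub>)"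
    unfolding rr_orthogonal_iff by blast
  then show ?thesis
    using assms z by (auto simp: Lower_rr_cont_ring)
qed

lemma rr_orthogonal_cont_ring_sym:
  assumes "r \<in> carrier (cont_ring X)" "s \<in> carrier (cont_ring X)" "rr_orthogonal (cont_ring X) r s"
  shows "rr_orthogonal (cont_ring X) s r"
  using assms by (simp add: rr_orthogonal_cont_ring_iff conj_commute)

text \<open>Where a common lower bound of \<open>r'\<close> and \<open>s\<close> is nonzero, it
  equals \<open>r'\<close>, which is then nonzero and so equals \<open>r\<close>. Hence it is a
  common lower bound of \<open>r\<close> and \<open>s\<close> as well.\<close>

lemma rr_orthogonal_cont_ring_mono:
  assumes "r \<in> carrier (cont_ring X)" "s \<in> carrier (cont_ring X)" "rr_orthogonal (cont_ring X) r s"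
    and "r' \<in> carrier (cont_ring X)" "r' \<sqsubseteq>\<^bsub>rr_order (cont_ring X)\<^esub> r"
  shows "rr_orthogonal (cont_ring X) r' s"
  using assms unfolding rr_orthogonal_cont_ring_iff[OF assms(1,2)]
    rr_orthogonal_cont_ring_iff[OF assms(4,2)] rr_le_cont_ring[OF assms(4)]
  by metis

lemma restriction_in_cont_ring:
  assumes "g \<in> carrier (cont_ring X)" "V \<subseteq> topspace X"
  shows "restriction V g \<in> carrier (cont_ring (subtopology X V))"
proof -
  have "topspace (subtopology X V) = V"
    using assms(2) by (simp add: Int_absorb1)
  then show ?thesis
    using restrict_in_cont_ring[of "subtopology X V" g] assms(1)
    by (simp add: carrier_cont_ring restriction_def continuous_map_from_subtopology)
qed

lemma rr_orthogonal_correction: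
  assumes good: "rr_good X" and V: "V \<subseteq> topspace X"
    and g: "g \<in> carrier (cont_ring X)" and k: "k \<in> carrier (cont_ring X)"
    and orth: "rr_orthogonal (cont_ring (subtopology X V)) (restriction V g) (restriction V k)"
  obtains g' where "g' \<in> carrier (cont_ring X)" "g' \<sqsubseteq>\<^bsub>rr_order (cont_ring X)\<^esub> g"
    "rr_orthogonal (cont_ring X) g' k" "restriction V g' = restriction V g"
proof -
  let ?L = "rr_order (cont_ring X)"
  obtain h where h: "greatest ?L h (Lower ?L {g, k})"
    using good g k unfolding rr_good_iff by blast
  then have "h \<in> Lower ?L {g, k}"
    by (simp add: greatest_def)
  then have hC: "h \<in> carrier (cont_ring X)"
    and hle: "\<forall>x\<in>topspace X. h x = 0 \<or> h x = g x \<and> h x = k x"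
    using g k by (simp_all add: Lower_rr_cont_ring)
  have hmax: "\<forall>x\<in>topspace X. l x = 0 \<or> l x = h x"
    if "l \<in> carrier (cont_ring X)" "\<forall>x\<in>topspace X. l x = 0 \<or> l x = g x \<and> l x = k x" for l
    using h that g k by (simp add: greatest_def Lower_rr_cont_ring flip: rr_le_cont_ring)
  have topV: "topspace (subtopology X V) = V"
    using V by (simp add: Int_absorb1)
  have hV: "\<forall>x\<in>V. h x = 0"
  \<comment> \<open>The restriction of \<open>h\<close> is a common lower bound of the restrictions
    of \<open>g\<close> and \<open>k\<close>, so \<open>orth\<close> forces it to vanish.\<close>
  proof -
    have "\<forall>x\<in>V. restriction V h x = 0 \<or>
        restriction V h x = restriction V g x \<and> restriction V h x = restriction V k x"
      using hle V by (auto simp: restriction_def)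
    then have "\<forall>x\<in>V. restriction V h x = 0"
      using orth restriction_in_cont_ring[OF hC V]
      unfolding rr_orthogonal_cont_ring_iff[OF restriction_in_cont_ring[OF g V]
          restriction_in_cont_ring[OF k V]] topV
      by blast
    then show ?thesis
      by (simp add: restriction_def)
  qed
  \<comment> \<open>At each point \<open>h\<close> is either 0 or \<open>g\<close>, so this
    difference is \<open>g\<close> where \<open>h\<close> vanishes and 0 elsewhere, yet stays
    continuous.\<close>
  define g' where "g' = restrict (\<lambda>x. g x - h x) (topspace X)"
  have g': "g' \<in> carrier (cont_ring X)"
    using g hC unfolding g'_def
    by (intro restrict_in_cont_ring continuous_map_diff) (auto simp: carrier_cont_ring)
  have le: "g' \<sqsubseteq>\<^bsub>?L\<^esub> g"
    unfolding rr_le_cont_ring[OF g'] using hle by (auto simp: g'_def)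
  have "rr_orthogonal (cont_ring X) g' k"
    unfolding rr_orthogonal_cont_ring_iff[OF g' k]
  proof (intro ballI impI)
    fix l x
    assume l: "l \<in> carrier (cont_ring X)"
      and lle: "\<forall>x\<in>topspace X. l x = 0 \<or> l x = g' x \<and> l x = k x" and x: "x \<in> topspace X"
    \<comment> \<open>Since \<open>g'\<close> lies below \<open>g\<close>, the bound
      \<open>l\<close> also competes with \<open>h\<close> for the infimum of \<open>g\<close> and
      \<open>k\<close>.\<close>
    have "\<forall>x\<in>topspace X. l x = 0 \<or> l x = g x \<and> l x = k x"
      using lle le unfolding rr_le_cont_ring[OF g'] by metis
    then have "l x = 0 \<or> l x = h x"
      using hmax l x by blast
    then show "l x = 0"
      \<comment> \<open>If \<open>l x\<close> were nonzero, then \<open>h x = l x\<close> would be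
        nonzero, so \<open>h x = g x\<close> and \<open>g' x = 0\<close>, contradicting
        \<open>l x = g' x\<close>.\<close>
      using bspec[OF lle x] bspec[OF hle x] x by (auto simp: g'_def)
  qed
  moreover have "restriction V g' = restriction V g"
    using hV V by (auto simp: restriction_def g'_def restrict_def fun_eq_iff)
  ultimately show thesis
    using that g' le by blast
qed

text \<open>Corrections can be chained: each one keeps the restriction to \<open>V\<close>, so the
  orthogonality hypothesis remains available for the next, and each one moves down in the order, so
  relations already achieved survive.\<close>

lemma rr_orthogonal_correction_finite:
  assumes good: "rr_good X" and V: "V \<subseteq> topspace X" and g: "g \<in> carrier (cont_ring X)"
    and "finite K" and "K \<subseteq> carrier (cont_ring X)"
    and "\<forall>k\<in>K. rr_orthogonal (cont_ring (subtopology X V)) (restriction V g) (restriction V k)"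
  shows "\<exists>g'\<in>carrier (cont_ring X). restriction V g' = restriction V g \<and>
    (\<forall>k\<in>K. rr_orthogonal (cont_ring X) g' k)"
  using assms(4-)
proof (induction K rule: finite_induct)
  case empty
  then show ?case
    using g by auto
next
  case (insert k K)
  then obtain g1 where g1: "g1 \<in> carrier (cont_ring X)" "restriction V g1 = restriction V g"
    "\<forall>k\<in>K. rr_orthogonal (cont_ring X) g1 k"
    by auto
  obtain g2 where g2: "g2 \<in> carrier (cont_ring X)" "g2 \<sqsubseteq>\<^bsub>rr_order (cont_ring X)\<^esub> g1"
    "rr_orthogonal (cont_ring X) g2 k" "restriction V g2 = restriction V g1"
    using rr_orthogonal_correction[OF good V g1(1), of k] insert.prems g1(2) by auto
  have "rr_orthogonal (cont_ring X) g2 k'" if "k' \<in> K" for k'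
    using that insert.prems g1 g2 rr_orthogonal_cont_ring_mono[of g1 X k' g2] by auto
  then show ?case
    using g1 g2 by auto
qed

theorem proposition3p12:
  fixes X :: "'a topology" and V :: "'a set" and f :: "nat \<Rightarrow> 'a \<Rightarrow> real"
  assumes "completely_regular_space X" and "Hausdorff_space X"
    and "rr_good X"
    and "C_embedded X V"
    and "rr_orthogonal_family (cont_ring (subtopology X V)) f"
  shows "\<exists>F :: nat \<Rightarrow> 'a \<Rightarrow> real.
    rr_orthogonal_family (cont_ring X) F \<and> (\<forall>n. restriction V (F n) = f n)"
proof -
  have V: "V \<subseteq> topspace X"
    and surj: "restriction V ` carrier (cont_ring X) = carrier (cont_ring (subtopology X V))"
    using assms(4) by (auto simp: C_embedded_def)
  have fC: "f n \<in> carrier (cont_ring (subtopology X V))" for n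
    using assms(5) by (auto simp: rr_orthogonal_family_def)
  have orth: "rr_orthogonal (cont_ring (subtopology X V)) (f i) (f j)" if "i \<noteq> j" for i j
    using assms(5) that by (auto simp: rr_orthogonal_family_def)
  \<comment> \<open>\<open>P F n r\<close> says that \<open>r\<close> may serve as the
    \<open>n\<close>-th member. It consults \<open>F\<close> only below \<open>n\<close>, as
    recursive choice along the well-order requires; the closing \<open>qed\<close> checks
    this.\<close>
  define P where "P F n r \<longleftrightarrow> r \<in> carrier (cont_ring X) \<and> restriction V r = f n \<and>
    (\<forall>i<n. rr_orthogonal (cont_ring X) r (F i))" for F :: "nat \<Rightarrow> 'a \<Rightarrow> real" and n r
  have "\<exists>F. \<forall>n. P F n (F n)"
  proof (rule dependent_wellorder_choice)
    fix F :: "nat \<Rightarrow> 'a \<Rightarrow> real" and n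
    assume F: "\<And>i. i < n \<Longrightarrow> P F i (F i)"
    obtain g where g: "g \<in> carrier (cont_ring X)" "restriction V g = f n"
      using fC[of n] surj by (metis imageE)
    have "\<exists>g'\<in>carrier (cont_ring X). restriction V g' = restriction V g \<and>
        (\<forall>k\<in>F ` {..<n}. rr_orthogonal (cont_ring X) g' k)"
      by (rule rr_orthogonal_correction_finite[OF assms(3) V g(1)])
        (use F g orth in \<open>auto simp: P_def\<close>)
    then show "\<exists>r. P F n r"
      using g by (auto simp: P_def)
  qed (simp add: P_def)
  then obtain F where F: "\<And>n. P F n (F n)"
    by blast
  have "rr_orthogonal (cont_ring X) (F i) (F j)" if "i \<noteq> j" for i j
    \<comment> \<open>\<open>P\<close> relates each member only to those of smaller index; symmetry
      covers \<open>i < j\<close>.\<close>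
    using that F[of i] F[of j] rr_orthogonal_cont_ring_sym[of "F j" X "F i"]
    by (cases i j rule: linorder_cases) (auto simp: P_def)
  then have "rr_orthogonal_family (cont_ring X) F \<and> (\<forall>n. restriction V (F n) = f n)"
    using F by (auto simp: rr_orthogonal_family_def P_def)
  then show ?thesis
    by blast
qed

end
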